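(* Let $E$ be an interval effect algebra in a partially ordered abelian group $G$, and let $S$ be a subset of $E$ with $1\in S$. Suppose there is a compatibility support mapping $[\![\cdot,\cdot]\!]:\mathrm{Fin}(S)\times\mathrm{Fin}(S)\to E$ for $S$. Then the mapping $\beta:\mathrm{Fin}(S)\to E$ given by $\beta(X)=[\![X,\{1\}]\!]$ is a witness mapping for $S$, and $D(X,A)=D_\beta(X,A)$ for all $X,A\in\mathrm{Fin}(S)$ with $X\subseteq A$.
   Context: An effect algebra is a partial algebra $(E;\oplus,0,1)$ with a partial binary operation $\oplus$ and constants $0,1$ such that: (E1) if $a\oplus b$ is defined, then $b\oplus a$ is defined and $a\oplus b=b\oplus a$; (E2) if $a\oplus b$ and $(a\oplus b)\oplus c$ are defined, then $b\oplus c$ and $a\oplus(b\oplus c)$ are defined and $(a\oplus b)\oplus c=a\oplus(b\oplus c)$; (E3) for every $a\in E$ there is a unique $a'\in E$ with $a\oplus a'=1$; (E4) if $a\oplus 1$ exists, then $a=0$. One writes $a\le b$ iff there is $c\in E$ with $a\oplus c=b$; this is a partial order with least element $0$ and greatest element $1$. The element $b\ominus a$ is defined iff $a\le b$, and then it is the unique element with $a\oplus(b\ominus a)=b$. Interval effect algebra: let $(G,\le)$ be a partially ordered abelian group and $u\in G$ a positive element. On $[0,u]_G=\{x\in G:0\le x\le u\}$ define $a\oplus b$ iff $a+b\le u$, and then $a\oplus b=a+b$. Then $([0,u]_G,\oplus,0,u)$ is an effect algebra (with unit $1=u$); effect algebras of this form are called interval effect algebras (in $G$). For a set $S$, $\mathrm{Fin}(S)$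 denotes the set of all finite subsets of $S$ (including $\emptyset$). Let $S\subseteq E$ with $1\in S$. A compatibility support mapping for $S$ is a mapping $[\![\cdot,\cdot]\!]:\mathrm{Fin}(S)\times\mathrm{Fin}(S)\to E$ such that for all $U,V,V_1,V_2\in\mathrm{Fin}(S)$ and $c\in S$: (a) if $V_1\subseteq V_2$ then $[\![U,V_1]\!]\le[\![U,V_2]\!]$; (b) $[\![U,V]\!]\le[\![U,\{1\}]\!]$; (c) $[\![U,\emptyset]\!]=0$; (d) $[\![\emptyset,\{c\}]\!]=c$; (e) if $c\notin U\cup V$, then $[\![U\cup\{c\},\{1\}]\!]\ominus[\![U\cup\{c\},V]\!]=[\![U,V\cup\{c\}]\!]\ominus[\![U,V]\!]$. For $X\subseteq A$ in $\mathrm{Fin}(S)$, $D(X,A)=[\![X,\{1\}]\!]\ominus[\![X,A\setminus X]\!]$. For a mapping $\beta:\mathrm{Fin}(S)\to G$ and $X\subseteq A$ in $\mathrm{Fin}(S)$, $D_\beta(X,A)=\sum_{X\subseteq Z\subseteq A}(-1)^{|X|+|Z|}\beta(Z)\in G$. A mapping $\beta:\mathrm{Fin}(S)\to E$ is a witness mapping for $S$ if: (A1) $\beta(\emptyset)=1$; (A2) $\beta(\{c\})=c$ for all $c\in S$; (A3) $D_\beta(X,A)\ge 0$ for all $X,A\in\mathrm{Fin}(S)$ with $X\subseteq A$. *)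

theory Defs
  imports Main
begin

text \<open>
  The partial operation is rendered as a total function into an option type; the value \<open>None\<close>
  means "undefined". Only its values on the carrier matter for the axioms.
\<close>

record 'a effect_alg =
  carr :: "'a set"
  oplus :: "'a \<Rightarrow> 'a \<Rightarrow> 'a option"
  ezero :: 'a
  eone :: 'a

locale effect_algebra =
  fixes E :: "'a effect_alg"
  assumes zero_closed: "ezero E \<in> carr E"
    and one_closed: "eone E \<in> carr E"
    and oplus_closed:
      "\<lbrakk>a \<in> carr E; b \<in> carr E; oplus E a b = Some x\<rbrakk> \<Longrightarrow> x \<in> carr E"
    and E1: "\<lbrakk>a \<in> carr E; b \<in> carr E; oplus E a b = Some x\<rbrakk> \<Longrightarrow> oplus E b a = Some x"
    and E2: "\<lbrakk>a \<in> carr E; b \<in> carr E; c \<in> carr E; oplus E a b = Some x; oplus E x c = Some y\<rbrakk>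
      \<Longrightarrow> \<exists>z. oplus E b c = Some z \<and> oplus E a z = Some y"
    and E3: "a \<in> carr E \<Longrightarrow> \<exists>!a'. a' \<in> carr E \<and> oplus E a a' = Some (eone E)"
    and E4: "\<lbrakk>a \<in> carr E; oplus E a (eone E) \<noteq> None\<rbrakk> \<Longrightarrow> a = ezero E"

definition ele :: "'a effect_alg \<Rightarrow> 'a \<Rightarrow> 'a \<Rightarrow> bool" where
  "ele E a b \<longleftrightarrow> (\<exists>c\<in>carr E. oplus E a c = Some b)"

definition ominus :: "'a effect_alg \<Rightarrow> 'a \<Rightarrow> 'a \<Rightarrow> 'a option" where
  "ominus E b a =
    (if ele E a b then Some (THE c. c \<in> carr E \<and> oplus E a c = Some b) else None)"

text \<open>
  The partially ordered abelian group is the whole type, of class \<open>ordered_ab_group_add\<close>.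
\<close>

definition interval_alg :: "'g::ordered_ab_group_add \<Rightarrow> 'g effect_alg" where
  "interval_alg u =
    \<lparr>carr = {x. 0 \<le> x \<and> x \<le> u},
     oplus = (\<lambda>a b. if 0 \<le> a \<and> a \<le> u \<and> 0 \<le> b \<and> b \<le> u \<and> a + b \<le> u then Some (a + b) else None),
     ezero = 0,
     eone = u\<rparr>"

definition interval_effect_algebra :: "'g::ordered_ab_group_add effect_alg \<Rightarrow> bool" where
  "interval_effect_algebra E \<longleftrightarrow> (\<exists>u\<ge>0. E = interval_alg u)"

lemma interval_effect_algebra_imp_effect_algebra:
  assumes "interval_effect_algebra E"
  shows "effect_algebra E"
proof -
  obtain u where u: "u \<ge> 0" "E = interval_alg u"
    using assms by (auto simp: interval_effect_algebra_def)
  show ?thesis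
  proof
    show "ezero E \<in> carr E" "eone E \<in> carr E"
      using u by (simp_all add: interval_alg_def)
  next
    fix a b x assume "a \<in> carr E" "b \<in> carr E" "oplus E a b = Some x"
    then show "x \<in> carr E" "oplus E b a = Some x"
      using u by (auto simp: interval_alg_def add.commute split: if_splits)
  next
    fix a b c x y
    assume "a \<in> carr E" "b \<in> carr E" "c \<in> carr E" "oplus E a b = Some x" "oplus E x c = Some y"
    then have abc: "0 \<le> a" "a \<le> u" "0 \<le> b" "b \<le> u" "0 \<le> c" "c \<le> u"
        "x = a + b" "y = a + b + c" "a + b + c \<le> u"
      using u by (auto simp: interval_alg_def split: if_splits)
    have "b + c \<le> a + (b + c)" using abc by simp
    then have "b + c \<le> u" using abc by (metis add.assoc order_trans)
    then show "\<exists>z. oplus E b c = Some z \<and> oplus E a z = Some y"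
      using u abc by (auto simp: interval_alg_def add.assoc)
  next
    fix a assume "a \<in> carr E"
    then show "\<exists>!a'. a' \<in> carr E \<and> oplus E a a' = Some (eone E)"
      using u by (intro ex1I[of _ "u - a"]) (auto simp: interval_alg_def split: if_splits)
  next
    fix a assume "a \<in> carr E" "oplus E a (eone E) \<noteq> None"
    then show "a = ezero E"
      using u by (auto simp: interval_alg_def split: if_splits)
  qed
qed

lemma ele_interval_alg:
  assumes "a \<in> carr (interval_alg u)" "b \<in> carr (interval_alg u)"
  shows "ele (interval_alg u) a b \<longleftrightarrow> a \<le> b"
proof
  assume "ele (interval_alg u) a b"
  then show "a \<le> b"
    by (auto simp: ele_def interval_alg_def split: if_splits)
next
  assume "a \<le> b"
  moreover have "b - a \<le> u"
    using assms by (simp add: interval_alg_def diff_le_eq add_increasing2)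
  ultimately show "ele (interval_alg u) a b"
    using assms unfolding ele_def
    by (intro bexI[of _ "b - a"]) (auto simp: interval_alg_def)
qed

lemma ominus_interval_alg:
  assumes "a \<in> carr (interval_alg u)" "b \<in> carr (interval_alg u)"
  shows "ominus (interval_alg u) b a = (if a \<le> b then Some (b - a) else None)"
proof -
  have "(THE c. c \<in> carr (interval_alg u) \<and> oplus (interval_alg u) a c = Some b) = b - a"
    if "a \<le> b"
  proof (rule the_equality)
    have "b - a \<le> u"
      using assms by (simp add: interval_alg_def diff_le_eq add_increasing2)
    then show "b - a \<in> carr (interval_alg u) \<and> oplus (interval_alg u) a (b - a) = Some b"
      using that assms by (auto simp: interval_alg_def)
  qed (auto simp: interval_alg_def split: if_splits)
  then show ?thesis
    by (simp add: ominus_def ele_interval_alg[OF assms])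
qed

text \<open>
  \<open>Fpow S\<close> is the set of finite subsets of \<open>S\<close>. In (e) both differences are defined by (b) and (a)
  respectively, so equality of options is equality of elements of \<open>E\<close>.
\<close>

definition compat_support_mapping ::
  "'a effect_alg \<Rightarrow> 'a set \<Rightarrow> ('a set \<Rightarrow> 'a set \<Rightarrow> 'a) \<Rightarrow> bool" where
  "compat_support_mapping E S m \<longleftrightarrow>
    (\<forall>U\<in>Fpow S. \<forall>V\<in>Fpow S. m U V \<in> carr E) \<and>
    (\<forall>U\<in>Fpow S. \<forall>V\<^sub>1\<in>Fpow S. \<forall>V\<^sub>2\<in>Fpow S. V\<^sub>1 \<subseteq> V\<^sub>2 \<longrightarrow> ele E (m U V\<^sub>1) (m U V\<^sub>2)) \<and>
    (\<forall>U\<in>Fpow S. \<forall>V\<in>Fpow S. ele E (m U V) (m U {eone E})) \<and>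
    (\<forall>U\<in>Fpow S. m U {} = ezero E) \<and>
    (\<forall>c\<in>S. m {} {c} = c) \<and>
    (\<forall>U\<in>Fpow S. \<forall>V\<in>Fpow S. \<forall>c\<in>S. c \<notin> U \<union> V \<longrightarrow>
      ominus E (m (U \<union> {c}) {eone E}) (m (U \<union> {c}) V) = ominus E (m U (V \<union> {c})) (m U V))"

definition D_supp ::
  "'a effect_alg \<Rightarrow> ('a set \<Rightarrow> 'a set \<Rightarrow> 'a) \<Rightarrow> 'a set \<Rightarrow> 'a set \<Rightarrow> 'a option" where
  "D_supp E m X A = ominus E (m X {eone E}) (m X (A - X))"

text \<open>
  A general abelian group has no multiplication, so the factor \<open>(-1) ^ (card X + card Z)\<close> is a
  case distinction on parity.
\<close>

definition D_beta :: "('g set \<Rightarrow> 'g::ab_group_add) \<Rightarrow> 'g set \<Rightarrow> 'g set \<Rightarrow> 'g" where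
  "D_beta \<beta> X A =
    (\<Sum>Z | X \<subseteq> Z \<and> Z \<subseteq> A. if even (card X + card Z) then \<beta> Z else - \<beta> Z)"

definition witness_mapping ::
  "'g::ordered_ab_group_add effect_alg \<Rightarrow> 'g set \<Rightarrow> ('g set \<Rightarrow> 'g) \<Rightarrow> bool" where
  "witness_mapping E S \<beta> \<longleftrightarrow>
    (\<forall>X\<in>Fpow S. \<beta> X \<in> carr E) \<and>
    \<beta> {} = eone E \<and>
    (\<forall>c\<in>S. \<beta> {c} = c) \<and>
    (\<forall>X\<in>Fpow S. \<forall>A\<in>Fpow S. X \<subseteq> A \<longrightarrow> 0 \<le> D_beta \<beta> X A)"

end

theory Submission
  imports Defs
begin

text \<open>
  In a group, condition (e) of a compatibility support mapping is a recursion. Write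
  \<open>\<beta> X\<close> for \<open>m X {1}\<close>. Solving (e) for \<open>m U (V \<union> {c})\<close> shows that the
  difference \<open>\<beta> U - m U V\<close>, which for \<open>U \<inter> V = {}\<close> is \<open>D(U, U \<union> V)\<close>, satisfies
  \<open>D(U, A \<union> {c}) = D(U, A) - D(U \<union> {c}, A \<union> {c})\<close> for \<open>c \<notin> A\<close> and
  \<open>U \<subseteq> A\<close>, and by (c) it starts with \<open>D(U, U) = \<beta> U\<close>. The alternating sum
  \<open>D\<^sub>\<beta>\<close> obeys the same recursion (lemma \<open>D_beta_insert\<close>: split the sets \<open>Z\<close> of the sum by whether they contain
  \<open>c\<close>) and the same initial condition, so the two agree by induction on \<open>V\<close>
  (lemma \<open>compat_support_diff_eq_D_beta\<close>).

  Positivity of \<open>D\<^sub>\<beta>\<close> is then condition (b), which says that the difference \<open>\<beta> U - m U V\<close> is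
  nonnegative. The value \<open>\<beta> {} = 1\<close> is (d) for \<open>c = 1\<close>, and \<open>\<beta> {c} = c\<close> is (e) for
  \<open>U = V = {}\<close>, combined with (c) and (d).
\<close>

lemma D_beta_self: "D_beta \<beta> X X = \<beta> X"
proof -
  have "{Z. X \<subseteq> Z \<and> Z \<subseteq> X} = {X}" by auto
  then show ?thesis by (simp add: D_beta_def)
qed

text \<open>
  A set between \<open>X\<close> and \<open>insert c A\<close> either avoids \<open>c\<close>, and then lies below \<open>A\<close>, or contains
  \<open>c\<close>, and then lies above \<open>insert c X\<close>. In the second case the sign relative to \<open>insert c X\<close>
  is opposite to the sign relative to \<open>X\<close>.
\<close>

lemma D_beta_insert:
  assumes "finite A" "X \<subseteq> A" "c \<notin> A"
  shows "D_beta \<beta> X (insert c A) = D_beta \<beta> X A - D_beta \<beta> (insert c X) (insert c A)"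
proof -
  let ?sgn = "\<lambda>X Z. if even (card X + card Z) then \<beta> Z else - \<beta> Z"
  let ?P = "{Z. X \<subseteq> Z \<and> Z \<subseteq> A}" and ?Q = "{Z. insert c X \<subseteq> Z \<and> Z \<subseteq> insert c A}"
  have split: "{Z. X \<subseteq> Z \<and> Z \<subseteq> insert c A} = ?P \<union> ?Q" by auto
  have "finite ?P" "finite ?Q"
    using assms(1) by (auto intro: finite_subset[of _ "Pow (insert c A)"])
  moreover have "?P \<inter> ?Q = {}" using assms(3) by auto
  ultimately have "D_beta \<beta> X (insert c A) = sum (?sgn X) ?P + sum (?sgn X) ?Q"
    unfolding D_beta_def split by (rule sum.union_disjoint)
  moreover have "card (insert c X) = Suc (card X)"
    using assms by (intro card_insert_disjoint) (auto intro: finite_subset)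
  then have "sum (?sgn X) ?Q = - sum (?sgn (insert c X)) ?Q"
    unfolding sum_negf[symmetric] by (intro sum.cong) auto
  ultimately show ?thesis by (simp add: D_beta_def)
qed

text \<open>
  The conditions of a compatibility support mapping in an interval effect algebra, with the
  partial operations replaced by those of the group. Condition (a) enters through the
  exchange law, where it makes the difference on the right-hand side of (e) a difference in the
  group.
\<close>

lemma compat_support_intervalD:
  fixes u :: "'g::ordered_ab_group_add"
  assumes m: "compat_support_mapping (interval_alg u) S m" and u: "u \<in> S"
  shows compat_support_closed:
      "U \<in> Fpow S \<Longrightarrow> V \<in> Fpow S \<Longrightarrow> m U V \<in> carr (interval_alg u)"
    and compat_support_le_top: "U \<in> Fpow S \<Longrightarrow> V \<in> Fpow S \<Longrightarrow> m U V \<le> m U {u}"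
    and compat_support_empty: "U \<in> Fpow S \<Longrightarrow> m U {} = 0"
    and compat_support_singleton: "c \<in> S \<Longrightarrow> m {} {c} = c"
    and compat_support_exchange:
      "U \<in> Fpow S \<Longrightarrow> V \<in> Fpow S \<Longrightarrow> c \<in> S \<Longrightarrow> c \<notin> U \<union> V \<Longrightarrow>
        m (insert c U) {u} - m (insert c U) V = m U (insert c V) - m U V"
proof -
  have one: "eone (interval_alg u) = u" and zero: "ezero (interval_alg u) = 0"
    by (simp_all add: interval_alg_def)
  have closed: "m U V \<in> carr (interval_alg u)" if "U \<in> Fpow S" "V \<in> Fpow S" for U V
    using m that by (simp add: compat_support_mapping_def)
  have le: "a \<le> b" if "ele (interval_alg u) a b" for a b
    using that by (auto simp: ele_def interval_alg_def split: if_splits)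
  have top: "m U V \<le> m U {u}" if "U \<in> Fpow S" "V \<in> Fpow S" for U V
    using m that by (intro le) (simp add: compat_support_mapping_def one)
  show "m U V \<in> carr (interval_alg u)" "m U V \<le> m U {u}"
    if "U \<in> Fpow S" "V \<in> Fpow S" using closed top that by auto
  show "m U {} = 0" if "U \<in> Fpow S"
    using m that by (simp add: compat_support_mapping_def zero)
  show "m {} {c} = c" if "c \<in> S"
    using m that by (simp add: compat_support_mapping_def)
  show "m (insert c U) {u} - m (insert c U) V = m U (insert c V) - m U V"
    if U: "U \<in> Fpow S" and V: "V \<in> Fpow S" and c: "c \<in> S" "c \<notin> U \<union> V"
  proof -
    have cU: "insert c U \<in> Fpow S" and cV: "insert c V \<in> Fpow S" and uF: "{u} \<in> Fpow S"
      using U V c u by (auto simp: Fpow_def)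
    have mono: "m U V \<le> m U (insert c V)"
      using m U V cV by (intro le) (simp add: compat_support_mapping_def subset_insertI)
    have "ominus (interval_alg u) (m (insert c U) {u}) (m (insert c U) V)
        = ominus (interval_alg u) (m U (insert c V)) (m U V)"
      using m U V c by (simp add: compat_support_mapping_def one)
    then show ?thesis
      using mono top[OF cU V] closed[OF U V] closed[OF U cV] closed[OF cU V] closed[OF cU uF]
      by (simp add: ominus_interval_alg)
  qed
qed

text \<open>
  The recursion for \<open>m X (insert c V)\<close> refers to \<open>V\<close> at both \<open>X\<close> and \<open>insert c X\<close>, so the
  induction is on \<open>V\<close> with \<open>X\<close> arbitrary.
\<close>

lemma compat_support_diff_eq_D_beta:
  fixes u :: "'g::ordered_ab_group_add"
  assumes m: "compat_support_mapping (interval_alg u) S m" and u: "u \<in> S"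
    and "finite V" "V \<subseteq> S" "X \<in> Fpow S" "X \<inter> V = {}"
  shows "m X {u} - m X V = D_beta (\<lambda>X. m X {u}) X (X \<union> V)"
  using assms(3-)
proof (induction V arbitrary: X)
  case empty
  then show ?case by (simp add: D_beta_self compat_support_empty[OF m u])
next
  case (insert c V)
  let ?D = "D_beta (\<lambda>X. m X {u})"
  have V: "V \<in> Fpow S" and X: "X \<in> Fpow S" "insert c X \<in> Fpow S"
    using insert.hyps insert.prems by (auto simp: Fpow_def)
  have c: "c \<in> S" "c \<notin> X \<union> V" using insert.hyps insert.prems by auto
  have "m X {u} - m X (insert c V)
      = (m X {u} - m X V) - (m (insert c X) {u} - m (insert c X) V)"
    using compat_support_exchange[OF m u X(1) V c] by simp
  also have "\<dots> = ?D X (X \<union> V) - ?D (insert c X) (insert c (X \<union> V))"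
    using insert.IH[of X] insert.IH[of "insert c X"] X insert.hyps insert.prems by simp
  also have "\<dots> = ?D X (X \<union> insert c V)"
    using D_beta_insert[of "X \<union> V" X c] c X V by (simp add: Fpow_def)
  finally show ?case .
qed

theorem proposition6:
  fixes E :: "'g::ordered_ab_group_add effect_alg"
    and S :: "'g set"
    and m :: "'g set \<Rightarrow> 'g set \<Rightarrow> 'g"
  assumes "interval_effect_algebra E"
    and "S \<subseteq> carr E"
    and "eone E \<in> S"
    and "compat_support_mapping E S m"
  shows "witness_mapping E S (\<lambda>X. m X {eone E}) \<and>
    (\<forall>X\<in>Fpow S. \<forall>A\<in>Fpow S. X \<subseteq> A \<longrightarrow>
      D_supp E m X A = Some (D_beta (\<lambda>X. m X {eone E}) X A))"
proof -
  obtain u where E: "E = interval_alg u"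
    using assms(1) by (auto simp: interval_effect_algebra_def)
  have one: "eone E = u" by (simp add: E interval_alg_def)
  have m: "compat_support_mapping (interval_alg u) S m" and u: "u \<in> S"
    using assms E one by simp_all
  have uF: "{u} \<in> Fpow S" and eF: "{} \<in> Fpow S" using u by (auto simp: Fpow_def)
  let ?\<beta> = "\<lambda>X. m X {u}"
  have diff: "D_beta ?\<beta> X A = m X {u} - m X (A - X)" and AX: "A - X \<in> Fpow S"
    if "X \<in> Fpow S" "A \<in> Fpow S" "X \<subseteq> A" for X A
  proof -
    show "A - X \<in> Fpow S" using that by (auto simp: Fpow_def)
    then show "D_beta ?\<beta> X A = m X {u} - m X (A - X)"
      using compat_support_diff_eq_D_beta[OF m u, of "A - X" X] that
      by (simp add: Fpow_def Un_absorb1)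
  qed
  have "?\<beta> {c} = c" if "c \<in> S" for c
  proof -
    have "{c} \<in> Fpow S" using that by (simp add: Fpow_def)
    then show ?thesis
      using compat_support_exchange[OF m u eF eF that]
        compat_support_empty[OF m u] compat_support_singleton[OF m u that] eF
      by simp
  qed
  moreover have "?\<beta> {} = u"
    using compat_support_singleton[OF m u u] .
  moreover have "0 \<le> D_beta ?\<beta> X A" if "X \<in> Fpow S" "A \<in> Fpow S" "X \<subseteq> A" for X A
    using compat_support_le_top[OF m u that(1) AX[OF that]] diff[OF that] by simp
  ultimately have "witness_mapping E S ?\<beta>"
    using compat_support_closed[OF m u _ uF] by (simp add: witness_mapping_def one E[symmetric])
  moreover have "D_supp E m X A = Some (D_beta ?\<beta> X A)"
    if X: "X \<in> Fpow S" and A: "A \<in> Fpow S" "X \<subseteq> A" for X A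
    using compat_support_closed[OF m u X AX[OF that]] compat_support_closed[OF m u X uF]
      compat_support_le_top[OF m u X AX[OF that]] diff[OF that]
    by (simp add: D_supp_def one) (simp add: E ominus_interval_alg)
  ultimately show ?thesis by (simp add: one)
qed

end
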